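(* Let $p_\lambda(\cdot)$ be a differentiable concave penalty function on $[0,\infty)$, let $Q(\boldsymbol\beta)=\sum_{i=1}^n \ell_i(\boldsymbol\beta)-n\sum_{j=1}^p p_\lambda(|\beta_j|)$ be the penalized log-likelihood, let $\{\boldsymbol\beta^{(k)}\}_{k\ge 0}$ be the iterates of the local linear approximation (LLA) algorithm, and let $$G(\boldsymbol\beta\mid\boldsymbol\beta^{(k)})=\sum_{i=1}^n \ell_i(\boldsymbol\beta)-n\sum_{j=1}^p\Big[p_\lambda(|\beta_j^{(k)}|)+p_\lambda'(|\beta_j^{(k)}|)\big(|\beta_j|-|\beta_j^{(k)}|\big)\Big].$$ Then, for all $k=0,1,2,\ldots$ and all $\boldsymbol\beta\in\mathbb{R}^p$, $$Q(\boldsymbol\beta)\ge G(\boldsymbol\beta\mid\boldsymbol\beta^{(k)})\quad\text{and}\quad Q(\boldsymbol\beta^{(k)})=G(\boldsymbol\beta^{(k)}\mid\boldsymbol\beta^{(k)}).$$ Furthermore, the LLA algorithm has the ascent property: for all $k=0,1,2,\ldots$, $$Q(\boldsymbol\beta^{(k+1)})\ge Q(\boldsymbol\beta^{(k)}).$$ If the penalty function $p_\lambda$ is strictly concave, then the last inequality always holds with "$>$" in place of "$\ge$".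
   Context: Given data $(\mathbf{x}_i,y_i)$, $i=1,\dots,n$, with $\mathbf{x}_i\in\mathbb{R}^p$, the function $\ell_i(\boldsymbol\beta)=\ell_i(\mathbf{x}_i^{\mathsf T}\boldsymbol\beta,y_i)$ is the conditional log-likelihood of $y_i$ given $\mathbf{x}_i$, as a function of $\boldsymbol\beta=(\beta_1,\dots,\beta_p)^{\mathsf T}\in\mathbb{R}^p$ (a dispersion parameter, if any, is suppressed). $\lambda$ is a fixed regularization parameter, and $p_\lambda'(0)$ denotes the right derivative of $p_\lambda$ at $0$, which is assumed to be finite. The LLA algorithm: start from an initial value $\boldsymbol\beta^{(0)}$ (the unpenalized maximum likelihood estimate); for $k=0,1,2,\dots$ let $$\boldsymbol\beta^{(k+1)}=\arg\max_{\boldsymbol\beta\in\mathbb{R}^p}\Big\{\sum_{i=1}^n\ell_i(\boldsymbol\beta)-n\sum_{j=1}^p p_\lambda'(|\beta_j^{(k)}|)\,|\beta_j|\Big\},$$ the maximizers being assumed to exist.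
   Formalization: The strict inequality is claimed except when β^(k) is itself a maximizer of its own LLA step and |β_j^(k+1)| = |β_j^(k)| for all j; in that case Q(β^(k+1)) = Q(β^(k)), so "always >" is false as stated (e.g. once the algorithm has reached a fixed point). *)

theory Defs
  imports "HOL-Analysis.Analysis"
begin

text \<open>
  Conventions: \<open>n\<close> is the sample size, observations are indexed by \<open>1, \<dots>, n\<close>, and \<open>\<real>\<^sup>p\<close> is
  \<open>real ^ 'p\<close>.  The term \<open>ll i u v\<close> is the conditional log-likelihood of the response \<open>v\<close> of
  observation \<open>i\<close> at linear predictor \<open>u\<close>.  The regularization parameter is fixed, so the penalty is
  a single function \<open>pen\<close>, of which only the values on \<open>[0, \<infinity>)\<close> matter; \<open>pen'\<close> stands for its
  derivative there (the right derivative at \<open>0\<close>).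
\<close>

definition strictly_concave_on :: "real set \<Rightarrow> (real \<Rightarrow> real) \<Rightarrow> bool" where
  "strictly_concave_on S f \<longleftrightarrow> convex S \<and>
     (\<forall>x\<in>S. \<forall>y\<in>S. \<forall>t. x \<noteq> y \<and> 0 < t \<and> t < 1 \<longrightarrow>
        (1 - t) * f x + t * f y < f ((1 - t) * x + t * y))"

definition log_lik ::
  "nat \<Rightarrow> (nat \<Rightarrow> real \<Rightarrow> 'y \<Rightarrow> real) \<Rightarrow> (nat \<Rightarrow> real ^ 'p) \<Rightarrow> (nat \<Rightarrow> 'y) \<Rightarrow> real ^ 'p \<Rightarrow> real" where
  "log_lik n ll x y \<beta> = (\<Sum>i = 1..n. ll i (x i \<bullet> \<beta>) (y i))"

definition penalized_log_lik ::
  "nat \<Rightarrow> (nat \<Rightarrow> real \<Rightarrow> 'y \<Rightarrow> real) \<Rightarrow> (nat \<Rightarrow> real ^ 'p) \<Rightarrow> (nat \<Rightarrow> 'y) \<Rightarrow>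
   (real \<Rightarrow> real) \<Rightarrow> real ^ 'p \<Rightarrow> real" where
  "penalized_log_lik n ll x y pen \<beta> =
     log_lik n ll x y \<beta> - real n * (\<Sum>j\<in>UNIV. pen \<bar>\<beta> $ j\<bar>)"

text \<open>The surrogate \<open>G(\<beta> | b)\<close>; the conditioning point \<open>b\<close> is the first of the two vector arguments.\<close>

definition lla_surrogate ::
  "nat \<Rightarrow> (nat \<Rightarrow> real \<Rightarrow> 'y \<Rightarrow> real) \<Rightarrow> (nat \<Rightarrow> real ^ 'p) \<Rightarrow> (nat \<Rightarrow> 'y) \<Rightarrow>
   (real \<Rightarrow> real) \<Rightarrow> (real \<Rightarrow> real) \<Rightarrow> real ^ 'p \<Rightarrow> real ^ 'p \<Rightarrow> real" where
  "lla_surrogate n ll x y pen pen' b \<beta> =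
     log_lik n ll x y \<beta> -
     real n * (\<Sum>j\<in>UNIV. pen \<bar>b $ j\<bar> + pen' \<bar>b $ j\<bar> * (\<bar>\<beta> $ j\<bar> - \<bar>b $ j\<bar>))"

definition lla_objective ::
  "nat \<Rightarrow> (nat \<Rightarrow> real \<Rightarrow> 'y \<Rightarrow> real) \<Rightarrow> (nat \<Rightarrow> real ^ 'p) \<Rightarrow> (nat \<Rightarrow> 'y) \<Rightarrow>
   (real \<Rightarrow> real) \<Rightarrow> real ^ 'p \<Rightarrow> real ^ 'p \<Rightarrow> real" where
  "lla_objective n ll x y pen' b \<beta> =
     log_lik n ll x y \<beta> - real n * (\<Sum>j\<in>UNIV. pen' \<bar>b $ j\<bar> * \<bar>\<beta> $ j\<bar>)"

text \<open>
  Maximizers need not be unique, so one step of the algorithm is a relation: \<open>c\<close> is an admissible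
  successor of \<open>b\<close>.
\<close>

definition lla_step ::
  "nat \<Rightarrow> (nat \<Rightarrow> real \<Rightarrow> 'y \<Rightarrow> real) \<Rightarrow> (nat \<Rightarrow> real ^ 'p) \<Rightarrow> (nat \<Rightarrow> 'y) \<Rightarrow>
   (real \<Rightarrow> real) \<Rightarrow> real ^ 'p \<Rightarrow> real ^ 'p \<Rightarrow> bool" where
  "lla_step n ll x y pen' b c \<longleftrightarrow> is_arg_max (lla_objective n ll x y pen' b) (\<lambda>_. True) c"

definition lla_iterates ::
  "nat \<Rightarrow> (nat \<Rightarrow> real \<Rightarrow> 'y \<Rightarrow> real) \<Rightarrow> (nat \<Rightarrow> real ^ 'p) \<Rightarrow> (nat \<Rightarrow> 'y) \<Rightarrow>
   (real \<Rightarrow> real) \<Rightarrow> (nat \<Rightarrow> real ^ 'p) \<Rightarrow> bool" where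
  "lla_iterates n ll x y pen' \<beta> \<longleftrightarrow>
     is_arg_max (log_lik n ll x y) (\<lambda>_. True) (\<beta> 0) \<and>
     (\<forall>k. lla_step n ll x y pen' (\<beta> k) (\<beta> (Suc k)))"

end

theory Submission
  imports Defs
begin

text \<open>
  A differentiable concave function lies below each of its tangents.  Applied to \<open>pen\<close> at
  \<open>\<bar>b $ j\<bar>\<close> and summed over \<open>j\<close>, this says that \<open>G(\<cdot> | b)\<close>, which replaces the penalty by its
  tangent, minorizes \<open>Q\<close>; the two agree at the point of contact \<open>b\<close>
  (\<open>lla_surrogate_le\<close>, \<open>lla_surrogate_self\<close>).

  As a function of its free argument the surrogate is the objective of the algorithm up to an
  additive constant, so an LLA step from \<open>b\<close> to \<open>c\<close> maximizes the surrogate and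
  \[
    Q(b) = G(b | b) \<le> G(c | b) \<le> Q(c).
  \]
  Strictness can enter at either inequality.  The first is strict unless \<open>b\<close> itself maximizes the
  objective.  For strictly concave \<open>pen\<close> the second is strict unless \<open>\<bar>c $ j\<bar> = \<bar>b $ j\<bar>\<close> for all \<open>j\<close>,
  because a strictly concave function meets its tangent only at the point of contact.
\<close>

text \<open>
  By concavity, covering a fraction \<open>s\<close> of the way from \<open>a\<close> to \<open>t\<close> changes \<open>f\<close> by at least
  \<open>s * (f t - f a)\<close>; divide by \<open>s\<close> and let \<open>s\<close> tend to zero.  Only this limit along the segment
  enters, so \<open>a\<close> may be an endpoint of \<open>S\<close>, as happens for a coefficient that has been set to zero.
\<close>
lemma concave_on_le_tangent:
  fixes f :: "real \<Rightarrow> real"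
  assumes conc: "concave_on S f" and a: "a \<in> S" and t: "t \<in> S"
    and deriv: "(f has_real_derivative D) (at a within S)"
  shows "f t \<le> f a + D * (t - a)"
proof -
  have "convex S"
    using conc by (rule concave_on_imp_convex)
  define g where "g s = (1 - s) * a + s * t" for s :: real
  have g_in: "g s \<in> S" if "s \<in> {0..1}" for s
    using convexD_alt[OF \<open>convex S\<close> a t] that by (simp add: g_def)
  have [simp]: "g 0 = a"
    by (simp add: g_def)
  have "(g has_real_derivative (t - a)) (at 0 within {0..1})"
    unfolding g_def by (auto intro!: derivative_eq_intros)
  moreover have "(f has_real_derivative D) (at (g 0) within g ` {0..1})"
    using deriv g_in by (auto intro: DERIV_subset)
  ultimately have "((f \<circ> g) has_real_derivative D * (t - a)) (at 0 within {0..1})"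
    by (rule DERIV_image_chain[rotated])
  then have lim: "((\<lambda>s. (f (g s) - f a) / s) \<longlongrightarrow> D * (t - a)) (at 0 within {0..1})"
    by (simp add: has_field_derivative_iff)
  have "f t - f a \<le> (f (g s) - f a) / s" if "0 < s" "s \<le> 1" for s
  proof -
    have "(1 - s) * f a + s * f t \<le> f (g s)"
      using concave_onD[OF conc, of s a t] that a t by (simp add: g_def)
    then show ?thesis
      using that by (simp add: field_simps)
  qed
  then have "\<forall>\<^sub>F s in at 0 within {0..1}. f t - f a \<le> (f (g s) - f a) / s"
    by (auto simp: eventually_at_filter)
  moreover have "at (0::real) within {0..1} \<noteq> bot"
    by (simp add: trivial_limit_within islimpt_Icc)
  ultimately have "f t - f a \<le> D * (t - a)"
    by (intro tendsto_lowerbound[OF lim])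
  then show ?thesis
    by simp
qed

lemma strictly_concave_on_imp_concave_on:
  assumes "strictly_concave_on S f"
  shows "concave_on S f"
  unfolding concave_on_iff
proof (intro conjI ballI allI impI)
  show "convex S"
    using assms by (simp add: strictly_concave_on_def)
next
  fix u v a b :: real
  assume uv: "u \<in> S" "v \<in> S" and ab: "0 \<le> a" "0 \<le> b" "a + b = 1"
  then have a: "a = 1 - b"
    by simp
  consider "u = v" | "b = 0" | "b = 1" | "u \<noteq> v" "0 < b" "b < 1"
    using ab by linarith
  then show "f (a *\<^sub>R u + b *\<^sub>R v) \<ge> a * f u + b * f v"
  proof cases
    case 1
    then show ?thesis
      by (simp add: a algebra_simps)
  next
    case 4
    then show ?thesis
      using assms uv unfolding strictly_concave_on_def by (force simp: a)
  qed (simp_all add: a)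
qed

text \<open>
  If the graph met its tangent again at \<open>t\<close>, it would rise strictly above the common chord at the
  midpoint, and that chord is part of the tangent.
\<close>
lemma strictly_concave_on_less_tangent:
  fixes f :: "real \<Rightarrow> real"
  assumes strict: "strictly_concave_on S f" and a: "a \<in> S" and t: "t \<in> S" and "t \<noteq> a"
    and deriv: "(f has_real_derivative D) (at a within S)"
  shows "f t < f a + D * (t - a)"
proof -
  define m where "m = (1 - 1/2) * a + 1/2 * t"
  have "convex S"
    using strict by (simp add: strictly_concave_on_def)
  then have "m \<in> S"
    using convexD_alt[OF _ a t, of "1/2"] by (simp add: m_def)
  then have "f m \<le> f a + D * (m - a)"
    using concave_on_le_tangent[OF strictly_concave_on_imp_concave_on[OF strict] a _ deriv] by blast
  moreover have "\<forall>s. a \<noteq> t \<and> 0 < s \<and> s < 1 \<longrightarrow> (1 - s) * f a + s * f t < f ((1 - s) * a + s * t)"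
    using strict a t by (simp add: strictly_concave_on_def)
  then have "(1 - 1/2) * f a + 1/2 * f t < f m"
    using \<open>t \<noteq> a\<close> unfolding m_def by (elim allE[of _ "1/2"]) simp
  moreover have "D * (m - a) = D * (t - a) / 2"
    by (simp add: m_def field_simps)
  ultimately show ?thesis
    by simp
qed

lemma lla_surrogate_le:
  assumes deriv: "\<And>t. t \<ge> 0 \<Longrightarrow> (pen has_real_derivative pen' t) (at t within {0..})"
    and conc: "concave_on {0..} pen"
  shows "lla_surrogate n ll x y pen pen' b \<beta> \<le> penalized_log_lik n ll x y pen \<beta>"
proof -
  have "pen \<bar>\<beta> $ j\<bar> \<le> pen \<bar>b $ j\<bar> + pen' \<bar>b $ j\<bar> * (\<bar>\<beta> $ j\<bar> - \<bar>b $ j\<bar>)" for j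
    by (rule concave_on_le_tangent[OF conc]) (auto intro: deriv)
  then show ?thesis
    unfolding lla_surrogate_def penalized_log_lik_def
    by (intro diff_left_mono mult_left_mono sum_mono) auto
qed

text \<open>
  The term \<open>log_lik n ll x y \<beta>\<close> is common to both sides, so one coordinate at which the tangent is
  missed is enough; \<open>n \<ge> 1\<close> keeps the penalty from being multiplied by zero.
\<close>
lemma lla_surrogate_less:
  assumes deriv: "\<And>t. t \<ge> 0 \<Longrightarrow> (pen has_real_derivative pen' t) (at t within {0..})"
    and strict: "strictly_concave_on {0..} pen"
    and "n \<ge> 1" and i: "\<bar>\<beta> $ i\<bar> \<noteq> \<bar>b $ i\<bar>"
  shows "lla_surrogate n ll x y pen pen' b \<beta> < penalized_log_lik n ll x y pen \<beta>"
proof -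
  have "pen \<bar>\<beta> $ j\<bar> \<le> pen \<bar>b $ j\<bar> + pen' \<bar>b $ j\<bar> * (\<bar>\<beta> $ j\<bar> - \<bar>b $ j\<bar>)" for j
    by (rule concave_on_le_tangent[OF strictly_concave_on_imp_concave_on[OF strict]])
      (auto intro: deriv)
  moreover have "pen \<bar>\<beta> $ i\<bar> < pen \<bar>b $ i\<bar> + pen' \<bar>b $ i\<bar> * (\<bar>\<beta> $ i\<bar> - \<bar>b $ i\<bar>)"
    by (rule strictly_concave_on_less_tangent[OF strict]) (use i in \<open>auto intro: deriv\<close>)
  ultimately have "(\<Sum>j\<in>UNIV. pen \<bar>\<beta> $ j\<bar>) <
      (\<Sum>j\<in>UNIV. pen \<bar>b $ j\<bar> + pen' \<bar>b $ j\<bar> * (\<bar>\<beta> $ j\<bar> - \<bar>b $ j\<bar>))"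
    by (intro sum_strict_mono_ex1) auto
  then show ?thesis
    using \<open>n \<ge> 1\<close> by (simp add: lla_surrogate_def penalized_log_lik_def)
qed

lemma lla_surrogate_self:
  "lla_surrogate n ll x y pen pen' b b = penalized_log_lik n ll x y pen b"
  by (simp add: lla_surrogate_def penalized_log_lik_def)

text \<open>
  The two functions of \<open>\<beta>\<close> differ by a constant, and therefore a step of the algorithm, which is
  defined through the objective, maximizes the surrogate.
\<close>
lemma lla_surrogate_eq_objective:
  "lla_surrogate n ll x y pen pen' b \<beta> =
    lla_objective n ll x y pen' b \<beta> - real n * (\<Sum>j\<in>UNIV. pen \<bar>b $ j\<bar> - pen' \<bar>b $ j\<bar> * \<bar>b $ j\<bar>)"
  by (simp add: lla_surrogate_def lla_objective_def algebra_simps sum.distrib sum_subtractf)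

lemma lla_step_iff_surrogate_max:
  "lla_step n ll x y pen' b c \<longleftrightarrow>
    (\<forall>\<beta>. lla_surrogate n ll x y pen pen' b \<beta> \<le> lla_surrogate n ll x y pen pen' b c)"
  by (simp add: lla_step_def is_arg_max_linorder lla_surrogate_eq_objective)

text \<open>If \<open>b\<close> is not a maximizer then every maximizer beats it, so the first inequality of
  \<open>G(b | b) \<le> G(c | b) \<le> Q(c)\<close> is strict.\<close>
lemma lla_step_surrogate_less:
  assumes "lla_step n ll x y pen' b c" and "\<not> lla_step n ll x y pen' b b"
  shows "lla_surrogate n ll x y pen pen' b b < lla_surrogate n ll x y pen pen' b c"
  using assms unfolding lla_step_iff_surrogate_max[of n ll x y pen' b _ pen]
  by (meson not_le order_trans)

theorem theorem1:
  fixes n :: nat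
    and ll :: "nat \<Rightarrow> real \<Rightarrow> 'y \<Rightarrow> real"
    and x :: "nat \<Rightarrow> real ^ 'p"
    and y :: "nat \<Rightarrow> 'y"
    and pen pen' :: "real \<Rightarrow> real"
    and \<beta> :: "nat \<Rightarrow> real ^ 'p"
  assumes n: "n \<ge> 1"
    and deriv: "\<And>t. t \<ge> 0 \<Longrightarrow> (pen has_real_derivative pen' t) (at t within {0..})"
    and concave: "concave_on {0..} pen"
    and iterates: "lla_iterates n ll x y pen' \<beta>"
  shows "(\<forall>k b. penalized_log_lik n ll x y pen b \<ge> lla_surrogate n ll x y pen pen' (\<beta> k) b) \<and>
    (\<forall>k. penalized_log_lik n ll x y pen (\<beta> k) = lla_surrogate n ll x y pen pen' (\<beta> k) (\<beta> k)) \<and>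
    (\<forall>k. penalized_log_lik n ll x y pen (\<beta> (Suc k)) \<ge> penalized_log_lik n ll x y pen (\<beta> k)) \<and>
    (strictly_concave_on {0..} pen \<longrightarrow>
      (\<forall>k. \<not> (lla_step n ll x y pen' (\<beta> k) (\<beta> k) \<and> (\<forall>j. \<bar>\<beta> (Suc k) $ j\<bar> = \<bar>\<beta> k $ j\<bar>)) \<longrightarrow>
        penalized_log_lik n ll x y pen (\<beta> (Suc k)) > penalized_log_lik n ll x y pen (\<beta> k)))"
proof -
  let ?Q = "penalized_log_lik n ll x y pen"
  let ?G = "lla_surrogate n ll x y pen pen'"
  have minor: "?G b c \<le> ?Q c" for b c
    by (rule lla_surrogate_le[OF deriv concave])
  have self: "?G b b = ?Q b" for b
    by (rule lla_surrogate_self)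
  have step: "lla_step n ll x y pen' (\<beta> k) (\<beta> (Suc k))" for k
    using iterates by (simp add: lla_iterates_def)
  have up: "?G (\<beta> k) (\<beta> k) \<le> ?G (\<beta> k) (\<beta> (Suc k))" for k
    using step lla_step_iff_surrogate_max by blast
  have ascent: "?Q (\<beta> k) \<le> ?Q (\<beta> (Suc k))" for k
    using up[of k] minor[of "\<beta> k" "\<beta> (Suc k)"] self[of "\<beta> k"] by linarith
  have strict_ascent: "?Q (\<beta> k) < ?Q (\<beta> (Suc k))"
    if strict: "strictly_concave_on {0..} pen"
      and moves: "\<not> (lla_step n ll x y pen' (\<beta> k) (\<beta> k) \<and> (\<forall>j. \<bar>\<beta> (Suc k) $ j\<bar> = \<bar>\<beta> k $ j\<bar>))"
    for k
  proof (cases "lla_step n ll x y pen' (\<beta> k) (\<beta> k)")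
    case True
    with moves obtain i where i: "\<bar>\<beta> (Suc k) $ i\<bar> \<noteq> \<bar>\<beta> k $ i\<bar>"
      by blast
    have "?G (\<beta> k) (\<beta> (Suc k)) < ?Q (\<beta> (Suc k))"
      by (rule lla_surrogate_less[OF deriv strict n i])
    then show ?thesis
      using up[of k] self[of "\<beta> k"] by linarith
  next
    case False
    then have "?G (\<beta> k) (\<beta> k) < ?G (\<beta> k) (\<beta> (Suc k))"
      by (rule lla_step_surrogate_less[OF step])
    then show ?thesis
      using minor[of "\<beta> k" "\<beta> (Suc k)"] self[of "\<beta> k"] by linarith
  qed
  show ?thesis
    using minor self ascent strict_ascent by auto
qed

end
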